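(* Consider the LMP game on the following network. There are three nodes and two lines: line $1$-$2$ with admittance $Y_{12}>0$ and capacity $C>0$, and line $2$-$3$ with admittance $Y_{23}>0$ and capacity $C'>C$. There are four generators: generator $1$ at node $1$, generator $2$ at node $2$, and generators $3$ and $4$ at node $3$. The demands are $D_1=D_2=0$ and $D_3=D$ with $D>C'$. The cost functions are $c_n(x_n)=a_nx_n$ for $n=1,2,3,4$, with $0\le a_1<a_2<a_3<a_4$. Then the LMP game has no (pure) Nash equilibrium.
   Context: Network: a connected power network with nodes $i=1,\dots,I$; line $i$-$j$ has admittance $Y_{ij}=Y_{ji}>0$ ($Y_{ij}=0$ if there is no line) and capacity $C_{ij}=C_{ji}>0$. There are generators $n=1,\dots,N$; $\mathcal N_i$ is the set of generators at node $i$; generator $n$ has cost function $c_n:\mathbb R_+\to\mathbb R_+$ with $c_n(0)=0$, $c_n'\ge 0$, $c_n''\ge 0$. Node $i$ has inelastic demand $D_i\ge 0$. LMP game. Each generator $n$ submits a bid $(p_n,s_n,q_n)$ with $0\le p_n\le q_n$, $s_n\ge0$, identified with the function $b_n(x_n)=p_nx_n$ for $x_n\le s_n$ and $b_n(x_n)=q_nx_n+(p_n-q_n)s_n$ for $x_n>s_n$. Given the bid profile $b=(b_1,\dots,b_N)$, the dispatch $x=(x_1,\dots,x_N)$ is (the $x$-part of) an optimal solution $(x,\theta)$ of: minimize $\sum_n b_n(x_n)$ over $x_n,\theta_i\in\mathbb R$ subject to $\sum_{n\in\mathcal N_i}x_n-D_i=\sum_jY_{ij}(\theta_i-\theta_j)$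 for all $i$; $Y_{ij}(\theta_i-\theta_j)\le C_{ij}$ for all ordered pairs $(i,j)$ joined by a line; $x_n\ge0$ for all $n$. The locational marginal prices (LMPs) $\pi=(\pi_i)_i$ are the optimal Lagrange multipliers of the power balance equalities: there are multipliers $\mu_{ij}\ge0$ for the line constraints such that for $n\in\mathcal N_i$: $\pi_i$ lies between the left and right derivatives of $b_n$ at $x_n$ if $x_n>0$, and $\pi_i$ is at most the right derivative of $b_n$ at $0$ if $x_n=0$; $\sum_jY_{ij}(\pi_i-\pi_j+\mu_{ij}-\mu_{ji})=0$ for all $i$; and $\mu_{ij}[Y_{ij}(\theta_i-\theta_j)-C_{ij}]=0$ for all $(i,j)$. If the optimal $\pi$ is not unique, the lexicographically smallest one is used (first minimize $\pi_1$, then $\pi_2$, and so on). If the optimal $x$ is not unique, any optimal $x$ may be the dispatch associated with $b$. The pair $(x,\pi)$ is an outcome associated with $b$. The payoff of generator $n\in\mathcal N_i$ is $u_n=\pi_ix_n-c_n(x_n)$. A (pure) Nash equilibrium is a bid profile $b$ together with an associated outcome $(x,\pi)$ such that no generator can be strictly better off by a unilateral change of his bid (that is, for no generator $n$ and no alternative bid of $n$ does an outcome associated with the changed profile give $n$ a strictly larger payoff). *)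

theory Defs
  imports Complex_Main
begin

text \<open>
  Nodes are numbered \<open>1, \<dots>, num_nodes\<close> and generators \<open>1, \<dots>, num_gens\<close>; vectors indexed by nodes
  or generators are functions on \<open>nat\<close>, whose values at other indices are irrelevant.
  Nodes \<open>i\<close> and \<open>j\<close> are joined by a line iff \<open>admittance i j > 0\<close>; \<open>capacity i j\<close> is meaningful
  only in that case. Cost functions are meaningful only on nonnegative arguments.
\<close>

record market =
  num_nodes :: nat
  num_gens :: nat
  admittance :: "nat \<Rightarrow> nat \<Rightarrow> real"
  capacity :: "nat \<Rightarrow> nat \<Rightarrow> real"
  demand :: "nat \<Rightarrow> real"
  gen_node :: "nat \<Rightarrow> nat"
  cost :: "nat \<Rightarrow> real \<Rightarrow> real"

definition nodes :: "market \<Rightarrow> nat set" where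
  "nodes M = {1..num_nodes M}"

definition gens :: "market \<Rightarrow> nat set" where
  "gens M = {1..num_gens M}"

definition gens_at :: "market \<Rightarrow> nat \<Rightarrow> nat set" where
  "gens_at M i = {n \<in> gens M. gen_node M n = i}"

definition lines :: "market \<Rightarrow> (nat \<times> nat) set" where
  "lines M = {(i, j). i \<in> nodes M \<and> j \<in> nodes M \<and> admittance M i j > 0}"

definition cost_function :: "(real \<Rightarrow> real) \<Rightarrow> bool" where
  "cost_function c \<longleftrightarrow> c 0 = 0 \<and> (\<forall>x\<ge>0. c x \<ge> 0) \<and>
     (\<exists>c' c''. \<forall>x\<ge>0. (c has_real_derivative c' x) (at x within {0..}) \<and> c' x \<ge> 0 \<and>
                     (c' has_real_derivative c'' x) (at x within {0..}) \<and> c'' x \<ge> 0)"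

definition power_market :: "market \<Rightarrow> bool" where
  "power_market M \<longleftrightarrow>
     (\<forall>i\<in>nodes M. \<forall>j\<in>nodes M. admittance M i j \<ge> 0 \<and> admittance M i j = admittance M j i) \<and>
     (\<forall>i\<in>nodes M. admittance M i i = 0) \<and>
     (\<forall>(i, j)\<in>lines M. capacity M i j > 0 \<and> capacity M i j = capacity M j i) \<and>
     (\<forall>i\<in>nodes M. \<forall>j\<in>nodes M. (i, j) \<in> (lines M)\<^sup>*) \<and>
     (\<forall>i\<in>nodes M. demand M i \<ge> 0) \<and>
     (\<forall>n\<in>gens M. gen_node M n \<in> nodes M \<and> cost_function (cost M n))"

record bid =
  bid_p :: real
  bid_s :: real
  bid_q :: real

definition valid_bid :: "bid \<Rightarrow> bool" where
  "valid_bid \<beta> \<longleftrightarrow> 0 \<le> bid_p \<beta> \<and> bid_p \<beta> \<le> bid_q \<beta> \<and> 0 \<le> bid_s \<beta>"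

definition bid_fun :: "bid \<Rightarrow> real \<Rightarrow> real" where
  "bid_fun \<beta> x = (if x \<le> bid_s \<beta> then bid_p \<beta> * x
                  else bid_q \<beta> * x + (bid_p \<beta> - bid_q \<beta>) * bid_s \<beta>)"

definition feasible :: "market \<Rightarrow> (nat \<Rightarrow> real) \<Rightarrow> (nat \<Rightarrow> real) \<Rightarrow> bool" where
  "feasible M x \<theta> \<longleftrightarrow>
     (\<forall>i\<in>nodes M. (\<Sum>n\<in>gens_at M i. x n) - demand M i
                   = (\<Sum>j\<in>nodes M. admittance M i j * (\<theta> i - \<theta> j))) \<and>
     (\<forall>(i, j)\<in>lines M. admittance M i j * (\<theta> i - \<theta> j) \<le> capacity M i j) \<and>
     (\<forall>n\<in>gens M. x n \<ge> 0)"

definition optimal_dispatch ::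
  "market \<Rightarrow> (nat \<Rightarrow> bid) \<Rightarrow> (nat \<Rightarrow> real) \<Rightarrow> (nat \<Rightarrow> real) \<Rightarrow> bool" where
  "optimal_dispatch M b x \<theta> \<longleftrightarrow> feasible M x \<theta> \<and>
     (\<forall>x' \<theta>'. feasible M x' \<theta>' \<longrightarrow>
        (\<Sum>n\<in>gens M. bid_fun (b n) (x n)) \<le> (\<Sum>n\<in>gens M. bid_fun (b n) (x' n)))"

definition optimal_multipliers ::
  "market \<Rightarrow> (nat \<Rightarrow> bid) \<Rightarrow> (nat \<Rightarrow> real) \<Rightarrow> (nat \<Rightarrow> real) \<Rightarrow> (nat \<Rightarrow> real) \<Rightarrow> bool" where
  "optimal_multipliers M b x \<theta> \<pi> \<longleftrightarrow>
     (\<exists>\<mu> :: nat \<Rightarrow> nat \<Rightarrow> real.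
        (\<forall>(i, j)\<in>lines M. \<mu> i j \<ge> 0) \<and>
        (\<forall>i\<in>nodes M. \<forall>n\<in>gens_at M i.
           (x n > 0 \<longrightarrow>
              (\<exists>l r. (bid_fun (b n) has_real_derivative l) (at_left (x n)) \<and>
                     (bid_fun (b n) has_real_derivative r) (at_right (x n)) \<and>
                     l \<le> \<pi> i \<and> \<pi> i \<le> r)) \<and>
           (x n = 0 \<longrightarrow>
              (\<exists>r. (bid_fun (b n) has_real_derivative r) (at_right 0) \<and> \<pi> i \<le> r))) \<and>
        (\<forall>i\<in>nodes M.
           (\<Sum>j\<in>nodes M. admittance M i j * (\<pi> i - \<pi> j + \<mu> i j - \<mu> j i)) = 0) \<and>
        (\<forall>(i, j)\<in>lines M.
           \<mu> i j * (admittance M i j * (\<theta> i - \<theta> j) - capacity M i j) = 0))"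

definition lex_le :: "market \<Rightarrow> (nat \<Rightarrow> real) \<Rightarrow> (nat \<Rightarrow> real) \<Rightarrow> bool" where
  "lex_le M \<pi> \<pi>' \<longleftrightarrow> (\<forall>i\<in>nodes M. \<pi> i = \<pi>' i) \<or>
     (\<exists>k\<in>nodes M. \<pi> k < \<pi>' k \<and> (\<forall>i\<in>nodes M. i < k \<longrightarrow> \<pi> i = \<pi>' i))"

definition LMP ::
  "market \<Rightarrow> (nat \<Rightarrow> bid) \<Rightarrow> (nat \<Rightarrow> real) \<Rightarrow> (nat \<Rightarrow> real) \<Rightarrow> (nat \<Rightarrow> real) \<Rightarrow> bool" where
  "LMP M b x \<theta> \<pi> \<longleftrightarrow> optimal_multipliers M b x \<theta> \<pi> \<and>
     (\<forall>\<pi>'. optimal_multipliers M b x \<theta> \<pi>' \<longrightarrow> lex_le M \<pi> \<pi>')"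

definition outcome ::
  "market \<Rightarrow> (nat \<Rightarrow> bid) \<Rightarrow> (nat \<Rightarrow> real) \<Rightarrow> (nat \<Rightarrow> real) \<Rightarrow> bool" where
  "outcome M b x \<pi> \<longleftrightarrow> (\<exists>\<theta>. optimal_dispatch M b x \<theta> \<and> LMP M b x \<theta> \<pi>)"

definition payoff :: "market \<Rightarrow> (nat \<Rightarrow> real) \<Rightarrow> (nat \<Rightarrow> real) \<Rightarrow> nat \<Rightarrow> real" where
  "payoff M x \<pi> n = \<pi> (gen_node M n) * x n - cost M n (x n)"

definition nash_equilibrium ::
  "market \<Rightarrow> (nat \<Rightarrow> bid) \<Rightarrow> (nat \<Rightarrow> real) \<Rightarrow> (nat \<Rightarrow> real) \<Rightarrow> bool" where
  "nash_equilibrium M b x \<pi> \<longleftrightarrow>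
     (\<forall>n\<in>gens M. valid_bid (b n)) \<and> outcome M b x \<pi> \<and>
     \<not> (\<exists>n\<in>gens M. \<exists>\<beta> x' \<pi>'. valid_bid \<beta> \<and> outcome M (b(n := \<beta>)) x' \<pi>' \<and>
           payoff M x' \<pi>' n > payoff M x \<pi> n)"

end

theory Submission
  imports Defs
begin

text \<open>
  On this tree network a dispatch is supported by prices \<open>\<pi>\<^sub>1 \<le> \<pi>\<^sub>2 \<le> \<pi>\<^sub>3\<close>, with equality across a line
  that is not saturated, and the prices supporting a given dispatch have a componentwise least
  element, which is the LMP. Suppose there is an equilibrium. Some generator at node 3 sells, so
  \<open>\<pi>\<^sub>3 \<ge> a\<^sub>3\<close>: at a lower price it would rather raise its bid or withhold a little. If line 1-2 is
  saturated, generator 1 could bid up to \<open>\<pi>\<^sub>2\<close> without losing sales, so \<open>\<pi>\<^sub>1 = \<pi>\<^sub>2\<close> always. Generator 2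
  can sell at least \<open>C' - C\<close> at any price below \<open>\<pi>\<^sub>3\<close>, so \<open>\<pi>\<^sub>2 > a\<^sub>2\<close>. Hence generators 1 and 2 both want to
  sell more at the price \<open>\<pi>\<^sub>2\<close>. If some generator \<open>m\<close> that faces this price had left slope \<open>\<pi>\<^sub>2\<close> at its
  output, one of them could take over a small amount from \<open>m\<close> without changing any price, because \<open>m\<close>
  would stay marginal at \<open>\<pi>\<^sub>2\<close>. So all these left slopes are smaller than \<open>\<pi>\<^sub>2\<close>, and the prices can be
  lowered, which contradicts that the LMP is least.
\<close>

declare One_nat_def [simp del]

section \<open>Bids and clearing prices\<close>

definition left_slope :: "bid \<Rightarrow> real \<Rightarrow> real" where
  "left_slope \<beta> y = (if y \<le> bid_s \<beta> then bid_p \<beta> else bid_q \<beta>)"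

definition right_slope :: "bid \<Rightarrow> real \<Rightarrow> real" where
  "right_slope \<beta> y = (if y < bid_s \<beta> then bid_p \<beta> else bid_q \<beta>)"

text \<open>The node of each generator in this network, independent of any \<open>market\<close>, so
  that bids and prices can be studied without the network record.\<close>

definition bus :: "nat \<Rightarrow> nat" where
  "bus n = (if n = 4 then 3 else n)"

lemma bus_simps [simp]: "bus 1 = 1" "bus 2 = 2" "bus 3 = 3" "bus 4 = 3"
  by (simp_all add: bus_def)

text \<open>The optimality condition of a single generator: \<open>P\<close> is a subgradient of the
  bid at \<open>y\<close> relative to nonnegative outputs, so the lower bound disappears at
  \<open>y = 0\<close>.\<close>

definition supports :: "bid \<Rightarrow> real \<Rightarrow> real \<Rightarrow> bool" where
  "supports \<beta> y P \<longleftrightarrow> (0 < y \<longrightarrow> left_slope \<beta> y \<le> P) \<and> P \<le> right_slope \<beta> y"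

definition feasible_dispatch :: "real \<Rightarrow> real \<Rightarrow> real \<Rightarrow> (nat \<Rightarrow> real) \<Rightarrow> bool" where
  "feasible_dispatch C C' D x \<longleftrightarrow>
     0 \<le> x 1 \<and> 0 \<le> x 2 \<and> 0 \<le> x 3 \<and> 0 \<le> x 4 \<and>
     x 1 \<le> C \<and> x 1 + x 2 \<le> C' \<and> x 1 + x 2 + x 3 + x 4 = D"

text \<open>Multiplier conditions with the line multipliers eliminated: each is the price rise along
  the flow, hence nonnegative, and zero on an unsaturated line.\<close>

definition clearing_prices ::
  "real \<Rightarrow> real \<Rightarrow> (nat \<Rightarrow> bid) \<Rightarrow> (nat \<Rightarrow> real) \<Rightarrow> (nat \<Rightarrow> real) \<Rightarrow> bool" where
  "clearing_prices C C' b x \<pi> \<longleftrightarrow>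
     (\<forall>n\<in>{1,2,3,4}. supports (b n) (x n) (\<pi> (bus n))) \<and>
     \<pi> 1 \<le> \<pi> 2 \<and> (x 1 < C \<longrightarrow> \<pi> 1 = \<pi> 2) \<and>
     \<pi> 2 \<le> \<pi> 3 \<and> (x 1 + x 2 < C' \<longrightarrow> \<pi> 2 = \<pi> 3)"

text \<open>As long as its owner sells, this bid forces the price to equal \<open>P\<close>.\<close>

definition flat_bid :: "real \<Rightarrow> bid" where
  "flat_bid P = \<lparr>bid_p = P, bid_s = 0, bid_q = P\<rparr>"

text \<open>Output \<open>y > 0\<close> is supported at every price from \<open>0\<close> to
  \<open>P\<close>, so the bid secures a quantity and leaves the price to be set by others.\<close>

definition step_bid :: "real \<Rightarrow> real \<Rightarrow> bid" where
  "step_bid P y = \<lparr>bid_p = 0, bid_s = y, bid_q = P\<rparr>"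

lemma valid_flat_bid: "0 \<le> P \<Longrightarrow> valid_bid (flat_bid P)"
  by (simp add: valid_bid_def flat_bid_def)

lemma valid_step_bid: "0 \<le> P \<Longrightarrow> 0 \<le> y \<Longrightarrow> valid_bid (step_bid P y)"
  by (simp add: valid_bid_def step_bid_def)

lemma supports_flat_bid: "supports (flat_bid P) y P' \<longleftrightarrow> (0 < y \<longrightarrow> P \<le> P') \<and> P' \<le> P"
  by (auto simp: supports_def flat_bid_def left_slope_def right_slope_def)

lemma supports_step_bid: "0 \<le> P \<Longrightarrow> supports (step_bid P y) y P"
  by (auto simp: supports_def step_bid_def left_slope_def right_slope_def)

lemma supports_mono_right: "supports \<beta> y P \<Longrightarrow> P \<le> Q \<Longrightarrow> Q \<le> right_slope \<beta> y \<Longrightarrow> supports \<beta> y Q"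
  by (auto simp: supports_def)

lemma supports_mono_left:
  "supports \<beta> y P \<Longrightarrow> Q \<le> P \<Longrightarrow> (0 < y \<Longrightarrow> left_slope \<beta> y \<le> Q) \<Longrightarrow> supports \<beta> y Q"
  by (auto simp: supports_def)

section \<open>Local moves along a bid curve\<close>

lemma left_slope_nonneg: "valid_bid \<beta> \<Longrightarrow> 0 \<le> left_slope \<beta> y"
  by (auto simp: valid_bid_def left_slope_def)

lemma left_slope_le_right_slope: "valid_bid \<beta> \<Longrightarrow> left_slope \<beta> y \<le> right_slope \<beta> y"
  by (auto simp: valid_bid_def left_slope_def right_slope_def)

text \<open>A small step to the left ends in the interior of a linear piece, where both slopes agree
  and only one price is possible. This keeps a generator marginal after it gives up a little
  output.\<close>

lemma decrease_along_left_slope: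
  assumes "0 < y" "0 < e"
  obtains d where "0 < d" "d < e" "d < y"
    "\<And>P. supports \<beta> (y - d) P \<longleftrightarrow> P = left_slope \<beta> y"
proof -
  \<comment> \<open>The left end of the linear piece that reaches \<open>y\<close> from below, cut
    off at zero output.\<close>
  define z where "z = (if y \<le> bid_s \<beta> then 0 else max 0 (bid_s \<beta>))"
  define d where "d = min e (y - z) / 2"
  have z: "0 \<le> z" "z < y" using assms by (auto simp: z_def)
  then have d: "0 < d" "d < e" "d < y - z" using assms by (auto simp: d_def min_def)
  then have "\<And>P. supports \<beta> (y - d) P \<longleftrightarrow> P = left_slope \<beta> y"
    using assms z by (auto simp: supports_def left_slope_def right_slope_def z_def split: if_splits)
  with that[of d] d z show thesis by auto
qed

lemma increase_along_right_slope:
  assumes "0 \<le> y" "0 < e"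
  obtains d where "0 < d" "d < e"
    "\<And>P. supports \<beta> (y + d) P \<longleftrightarrow> P = right_slope \<beta> y"
proof -
  define d where "d = (if y < bid_s \<beta> then min e (bid_s \<beta> - y) else e) / 2"
  have d: "0 < d" "d < e" using assms by (auto simp: d_def min_def)
  have "\<And>P. supports \<beta> (y + d) P \<longleftrightarrow> P = right_slope \<beta> y"
    using assms d by (auto simp: supports_def left_slope_def right_slope_def d_def min_def field_simps split: if_splits)
  with that[of d] d show thesis by auto
qed

text \<open>The largest output up to \<open>C\<close> that the bid supplies at price
  \<open>P\<close>. Below \<open>C\<close> the strict inequality leaves room to raise the price
  without changing this output.\<close>

lemma supply_at_price:
  assumes "valid_bid \<beta>" "0 < C"
  obtains y where "0 \<le> y" "y \<le> C" "0 < y \<Longrightarrow> left_slope \<beta> y \<le> P" "y < C \<Longrightarrow> P < right_slope \<beta> y"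
proof -
  consider "bid_q \<beta> \<le> P" | "P < bid_q \<beta>" "bid_p \<beta> \<le> P" | "P < bid_p \<beta>" by linarith
  then show thesis
  proof cases
    case 1
    with assms show ?thesis by (intro that[of C]) (auto simp: left_slope_def valid_bid_def)
  next
    case 2
    with assms show ?thesis
      by (intro that[of "min C (bid_s \<beta>)"])
        (auto simp: left_slope_def right_slope_def valid_bid_def min_def split: if_splits)
  next
    case 3
    with assms show ?thesis
      by (intro that[of 0]) (auto simp: left_slope_def right_slope_def valid_bid_def)
  qed
qed

section \<open>The least clearing price vector\<close>

text \<open>The clearing conditions are weak inequalities and equalities between prices and
  constants, so they survive componentwise infima once all three prices are bounded below.\<close>

lemma least_clearing_prices:
  assumes "0 < C" "C < C'" "C' < D" and x: "feasible_dispatch C C' D x"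
    and \<pi>: "clearing_prices C C' b x \<pi>"
  obtains \<rho> where "clearing_prices C C' b x \<rho>"
    "\<And>\<pi>'. clearing_prices C C' b x \<pi>' \<Longrightarrow> \<rho> 1 \<le> \<pi>' 1 \<and> \<rho> 2 \<le> \<pi>' 2 \<and> \<rho> 3 \<le> \<pi>' 3"
proof -
  define S where "S = {\<pi>. clearing_prices C C' b x \<pi>}"
  define V where "V i = (\<lambda>\<pi>. \<pi> i) ` S" for i :: nat
  define \<rho> where "\<rho> i = Inf (V i)" for i
  have ne: "V i \<noteq> {}" for i using \<pi> by (auto simp: V_def S_def)
  have "x 3 > 0 \<or> x 4 > 0" using x assms by (auto simp: feasible_dispatch_def)
  then obtain l3 where l3: "\<And>\<pi>. \<pi> \<in> S \<Longrightarrow> l3 \<le> \<pi> 3"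
  proof
    assume "x 3 > 0"
    then show thesis
      by (intro that[of "left_slope (b 3) (x 3)"]) (auto simp: S_def clearing_prices_def supports_def)
  next
    assume "x 4 > 0"
    then show thesis
      by (intro that[of "left_slope (b 4) (x 4)"]) (auto simp: S_def clearing_prices_def supports_def)
  qed
  obtain l2 where l2: "\<And>\<pi>. \<pi> \<in> S \<Longrightarrow> l2 \<le> \<pi> 2"
  proof (cases "x 1 + x 2 < C'")
    case True
    then show thesis using l3 by (intro that[of l3]) (force simp: S_def clearing_prices_def)
  next
    case False
    then have "x 2 > 0" using x assms by (auto simp: feasible_dispatch_def)
    then show thesis
      by (intro that[of "left_slope (b 2) (x 2)"]) (auto simp: S_def clearing_prices_def supports_def)
  qed
  obtain l1 where l1: "\<And>\<pi>. \<pi> \<in> S \<Longrightarrow> l1 \<le> \<pi> 1"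
  proof (cases "x 1 < C")
    case True
    then show thesis using l2 by (intro that[of l2]) (force simp: S_def clearing_prices_def)
  next
    case False
    then have "x 1 > 0" using assms by auto
    then show thesis
      by (intro that[of "left_slope (b 1) (x 1)"]) (auto simp: S_def clearing_prices_def supports_def)
  qed
  have bdd: "bdd_below (V i)" if "i \<in> {1,2,3}" for i
    using that l1 l2 l3 by (auto simp: V_def bdd_below_def)
  have lower: "\<rho> i \<le> \<pi>' i" if "\<pi>' \<in> S" "i \<in> {1,2,3}" for \<pi>' i
    unfolding \<rho>_def using that bdd[of i] by (auto intro!: cInf_lower simp: V_def)
  have greatest: "l \<le> \<rho> i" if "\<And>\<pi>'. \<pi>' \<in> S \<Longrightarrow> l \<le> \<pi>' i" for l i
    unfolding \<rho>_def using that ne[of i] by (auto intro!: cInf_greatest simp: V_def)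
  have eq: "\<rho> i = \<rho> j" if "\<And>\<pi>'. \<pi>' \<in> S \<Longrightarrow> \<pi>' i = \<pi>' j" for i j
    unfolding \<rho>_def V_def using that by (metis (mono_tags, lifting) image_cong)
  have sup: "supports (b n) (x n) (\<rho> (bus n))" if n: "n \<in> {1,2,3,4}" for n
  proof -
    have "bus n \<in> {1,2,3}" using n by (auto simp: bus_def)
    then have "\<rho> (bus n) \<le> \<pi> (bus n)" using lower \<pi> by (simp add: S_def)
    moreover have "left_slope (b n) (x n) \<le> \<rho> (bus n)" if "x n > 0"
      using that n by (intro greatest) (auto simp: S_def clearing_prices_def supports_def)
    moreover have "supports (b n) (x n) (\<pi> (bus n))" using \<pi> n by (auto simp: clearing_prices_def)
    ultimately show ?thesis by (blast intro: supports_mono_left)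
  qed
  have "\<rho> i \<le> \<rho> j" if "i \<in> {1,2,3}" "\<And>\<pi>'. \<pi>' \<in> S \<Longrightarrow> \<pi>' i \<le> \<pi>' j" for i j
    using that lower by (intro greatest) (meson order_trans)
  from this[of 1 2] this[of 2 3] have "\<rho> 1 \<le> \<rho> 2" "\<rho> 2 \<le> \<rho> 3"
    by (auto simp: S_def clearing_prices_def)
  moreover have "\<rho> 1 = \<rho> 2" if "x 1 < C" using that by (intro eq) (auto simp: S_def clearing_prices_def)
  moreover have "\<rho> 2 = \<rho> 3" if "x 1 + x 2 < C'" using that by (intro eq) (auto simp: S_def clearing_prices_def)
  ultimately have "clearing_prices C C' b x \<rho>" using sup by (auto simp: clearing_prices_def)
  with lower that show thesis by (auto simp: S_def)
qed

section \<open>One-sided derivatives and convexity of bid functions\<close>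

lemma bid_fun_left_derivative:
  "(bid_fun \<beta> has_real_derivative l) (at_left y) \<longleftrightarrow> l = left_slope \<beta> y"
proof -
  have "(bid_fun \<beta> has_real_derivative left_slope \<beta> y) (at_left y)"
  proof (cases "y \<le> bid_s \<beta>")
    case True
    have "((\<lambda>z. bid_p \<beta> * z) has_real_derivative bid_p \<beta>) (at_left y)"
      by (auto intro!: derivative_eq_intros)
    moreover have "\<forall>\<^sub>F z in at_left y. bid_p \<beta> * z = bid_fun \<beta> z"
      using True by (auto simp: eventually_at_filter bid_fun_def)
    ultimately show ?thesis
      using True by (subst (asm) has_field_derivative_cong_eventually) (auto simp: left_slope_def bid_fun_def)
  next
    case False
    have "((\<lambda>z. bid_q \<beta> * z + (bid_p \<beta> - bid_q \<beta>) * bid_s \<beta>) has_real_derivative bid_q \<beta>) (at_left y)"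
      by (auto intro!: derivative_eq_intros)
    moreover have "\<forall>\<^sub>F z in at_left y. bid_s \<beta> < z"
      using False by (intro eventually_at_left_real[THEN eventually_mono, of "bid_s \<beta>" y]) auto
    then have "\<forall>\<^sub>F z in at_left y. bid_q \<beta> * z + (bid_p \<beta> - bid_q \<beta>) * bid_s \<beta> = bid_fun \<beta> z"
      by eventually_elim (simp add: bid_fun_def)
    ultimately show ?thesis
      using False by (subst (asm) has_field_derivative_cong_eventually) (auto simp: left_slope_def bid_fun_def)
  qed
  then show ?thesis by (metis has_field_derivative_unique trivial_limit_at_left_real)
qed

lemma bid_fun_right_derivative:
  "(bid_fun \<beta> has_real_derivative r) (at_right y) \<longleftrightarrow> r = right_slope \<beta> y"
proof -
  have "(bid_fun \<beta> has_real_derivative right_slope \<beta> y) (at_right y)"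
  proof (cases "y < bid_s \<beta>")
    case True
    have "((\<lambda>z. bid_p \<beta> * z) has_real_derivative bid_p \<beta>) (at_right y)"
      by (auto intro!: derivative_eq_intros)
    moreover have "\<forall>\<^sub>F z in at_right y. z < bid_s \<beta>"
      using True by (intro eventually_at_right_real[THEN eventually_mono, of y "bid_s \<beta>"]) auto
    then have "\<forall>\<^sub>F z in at_right y. bid_p \<beta> * z = bid_fun \<beta> z"
      by eventually_elim (simp add: bid_fun_def)
    ultimately show ?thesis
      using True by (subst (asm) has_field_derivative_cong_eventually) (auto simp: right_slope_def bid_fun_def)
  next
    case False
    have "((\<lambda>z. bid_q \<beta> * z + (bid_p \<beta> - bid_q \<beta>) * bid_s \<beta>) has_real_derivative bid_q \<beta>) (at_right y)"
      by (auto intro!: derivative_eq_intros)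
    moreover have "\<forall>\<^sub>F z in at_right y. bid_q \<beta> * z + (bid_p \<beta> - bid_q \<beta>) * bid_s \<beta> = bid_fun \<beta> z"
      using False by (auto simp: eventually_at_filter bid_fun_def)
    ultimately show ?thesis
      using False by (subst (asm) has_field_derivative_cong_eventually)
        (auto simp: right_slope_def bid_fun_def algebra_simps)
  qed
  then show ?thesis by (metis has_field_derivative_unique trivial_limit_at_right_real)
qed

lemma supports_iff_derivatives:
  assumes "valid_bid \<beta>" "0 \<le> y"
  shows "supports \<beta> y P \<longleftrightarrow>
    (y > 0 \<longrightarrow> (\<exists>l r. (bid_fun \<beta> has_real_derivative l) (at_left y) \<and>
                     (bid_fun \<beta> has_real_derivative r) (at_right y) \<and> l \<le> P \<and> P \<le> r)) \<and>
    (y = 0 \<longrightarrow> (\<exists>r. (bid_fun \<beta> has_real_derivative r) (at_right 0) \<and> P \<le> r))"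
  using assms by (auto simp: supports_def bid_fun_left_derivative bid_fun_right_derivative)

text \<open>Since \<open>bid_p \<beta> \<le> bid_q \<beta>\<close>, the bid function is the maximum
  of its two affine pieces and hence convex. At \<open>y = 0\<close> the right slope alone suffices
  because \<open>z\<close> is nonnegative.\<close>

lemma bid_fun_subgradient:
  assumes \<beta>: "valid_bid \<beta>" and P: "supports \<beta> y P" and y: "0 \<le> y" "0 \<le> z"
  shows "bid_fun \<beta> y + P * (z - y) \<le> bid_fun \<beta> z"
proof -
  have max: "bid_fun \<beta> w = max (bid_p \<beta> * w) (bid_q \<beta> * w + (bid_p \<beta> - bid_q \<beta>) * bid_s \<beta>)" for w
  proof -
    have "0 \<le> (bid_q \<beta> - bid_p \<beta>) * (bid_s \<beta> - w)" if "w \<le> bid_s \<beta>"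
      using that \<beta> by (simp add: valid_bid_def)
    moreover have "0 \<le> (bid_q \<beta> - bid_p \<beta>) * (w - bid_s \<beta>)" if "bid_s \<beta> < w"
      using that \<beta> by (simp add: valid_bid_def)
    ultimately show ?thesis by (auto simp: bid_fun_def max_def algebra_simps)
  qed
  show ?thesis
  proof (cases "y \<le> z")
    case True
    have "P * (z - y) \<le> right_slope \<beta> y * (z - y)"
      using True P by (intro mult_right_mono) (auto simp: supports_def)
    moreover have "bid_fun \<beta> y + right_slope \<beta> y * (z - y) \<le> bid_fun \<beta> z"
    proof (cases "y < bid_s \<beta>")
      case True
      then show ?thesis unfolding max[of z] by (auto simp: right_slope_def bid_fun_def algebra_simps)
    next
      case False
      then have "bid_fun \<beta> y = bid_q \<beta> * y + (bid_p \<beta> - bid_q \<beta>) * bid_s \<beta>"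
        by (auto simp: bid_fun_def algebra_simps)
      with False show ?thesis unfolding max[of z] by (auto simp: right_slope_def algebra_simps)
    qed
    ultimately show ?thesis by linarith
  next
    case False
    then have "left_slope \<beta> y \<le> P" using P y by (auto simp: supports_def)
    then have "P * (z - y) \<le> left_slope \<beta> y * (z - y)"
      using False by (intro mult_right_mono_neg) auto
    moreover have "bid_fun \<beta> y + left_slope \<beta> y * (z - y) \<le> bid_fun \<beta> z"
      unfolding max[of z] by (auto simp: left_slope_def bid_fun_def algebra_simps)
    ultimately show ?thesis by linarith
  qed
qed

section \<open>Outcomes of the three-node line\<close>

locale three_node_line =
  fixes M :: market and Y12 Y23 C C' D :: real
  assumes market: "power_market M"
    and sizes: "num_nodes M = 3" "num_gens M = 4"
    and Y: "0 < Y12" "0 < Y23"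
    and admittance: "\<forall>i\<in>nodes M. \<forall>j\<in>nodes M. admittance M i j =
           (if {i, j} = {1, 2} then Y12 else if {i, j} = {2, 3} then Y23 else 0)"
    and capacity: "capacity M 1 2 = C" "capacity M 2 3 = C'"
    and C: "0 < C" "C < C'" "C' < D"
    and gen_node: "gen_node M 1 = 1" "gen_node M 2 = 2" "gen_node M 3 = 3" "gen_node M 4 = 3"
    and demand: "demand M 1 = 0" "demand M 2 = 0" "demand M 3 = D"
begin

section \<open>Elimination of angles and line multipliers\<close>

lemma nodes_eq: "nodes M = {1,2,3}"
  by (auto simp: nodes_def sizes One_nat_def)

lemma gens_eq: "gens M = {1,2,3,4}"
  by (auto simp: gens_def sizes One_nat_def)

lemma gens_at_eq: "gens_at M 1 = {1}" "gens_at M 2 = {2}" "gens_at M 3 = {3,4}"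
  by (auto simp: gens_at_def gens_eq gen_node)

lemma admittance_eq:
  "admittance M 1 1 = 0" "admittance M 1 2 = Y12" "admittance M 1 3 = 0"
  "admittance M 2 1 = Y12" "admittance M 2 2 = 0" "admittance M 2 3 = Y23"
  "admittance M 3 1 = 0" "admittance M 3 2 = Y23" "admittance M 3 3 = 0"
  using admittance[rule_format, unfolded nodes_eq] by (simp_all add: doubleton_eq_iff)

lemma lines_eq: "lines M = {(1,2),(2,1),(2,3),(3,2)}"
  using Y by (auto simp: lines_def nodes_eq admittance_eq)

lemma capacity_eq:
  "capacity M 1 2 = C" "capacity M 2 1 = C" "capacity M 2 3 = C'" "capacity M 3 2 = C'"
  proof -
  have "\<forall>(i, j)\<in>lines M. capacity M i j = capacity M j i"
    using market unfolding power_market_def by blast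
  then have "capacity M 2 1 = capacity M 1 2" "capacity M 3 2 = capacity M 2 3"
    unfolding lines_eq by blast+
  then show "capacity M 1 2 = C" "capacity M 2 1 = C" "capacity M 2 3 = C'" "capacity M 3 2 = C'"
    unfolding capacity by (simp_all only:)
qed

lemma sum_nodes: "(\<Sum>i\<in>nodes M. f i) = f 1 + f 2 + f 3" for f :: "nat \<Rightarrow> real"
  by (simp add: nodes_eq)

lemma sum_gens: "(\<Sum>n\<in>gens M. f n) = f 1 + f 2 + f 3 + f 4" for f :: "nat \<Rightarrow> real"
  by (simp add: gens_eq)

text \<open>On a tree the injections determine the flows. The limits against the flow direction hold
  automatically because \<open>x 1\<close> and \<open>x 1 + x 2\<close> are nonnegative.\<close>

lemma feasible_iff:
  "feasible M x \<theta> \<longleftrightarrow> feasible_dispatch C C' D x \<and>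
     x 1 = Y12 * (\<theta> 1 - \<theta> 2) \<and> x 1 + x 2 = Y23 * (\<theta> 2 - \<theta> 3)" (is "_ \<longleftrightarrow> ?R")
proof -
  have flip: "Y12 * (\<theta> 2 - \<theta> 1) = - (Y12 * (\<theta> 1 - \<theta> 2))" "Y23 * (\<theta> 3 - \<theta> 2) = - (Y23 * (\<theta> 2 - \<theta> 3))"
    by (simp_all add: algebra_simps)
  have "feasible M x \<theta> \<longleftrightarrow>
      (x 1 = Y12 * (\<theta> 1 - \<theta> 2) \<and>
       x 2 = - (Y12 * (\<theta> 1 - \<theta> 2)) + Y23 * (\<theta> 2 - \<theta> 3) \<and>
       x 3 + x 4 - D = - (Y23 * (\<theta> 2 - \<theta> 3))) \<and>
      (Y12 * (\<theta> 1 - \<theta> 2) \<le> C \<and> - (Y12 * (\<theta> 1 - \<theta> 2)) \<le> C \<and>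
       Y23 * (\<theta> 2 - \<theta> 3) \<le> C' \<and> - (Y23 * (\<theta> 2 - \<theta> 3)) \<le> C') \<and>
      (0 \<le> x 1 \<and> 0 \<le> x 2 \<and> 0 \<le> x 3 \<and> 0 \<le> x 4)"
    unfolding feasible_def sum_nodes
    by (simp add: nodes_eq lines_eq gens_eq gens_at_eq demand admittance_eq capacity_eq flip)
  also have "\<dots> \<longleftrightarrow> ?R"
    unfolding feasible_dispatch_def using C by argo
  finally show ?thesis .
qed

text \<open>The reverse limits are never tight, so complementary slackness gives
  \<open>\<mu> 2 1 = \<mu> 3 2 = 0\<close>. The balance equations at nodes 1 and 3 then identify
  \<open>\<mu> 1 2\<close> and \<open>\<mu> 2 3\<close> with the price differences.\<close>

lemma optimal_multipliers_iff:
  assumes f: "feasible M x \<theta>" and b: "\<And>n. n \<in> gens M \<Longrightarrow> valid_bid (b n)"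
  shows "optimal_multipliers M b x \<theta> \<pi> \<longleftrightarrow> clearing_prices C C' b x \<pi>"
proof -
  have x: "0 \<le> x 1" "0 \<le> x 2" "0 \<le> x 3" "0 \<le> x 4" "x 1 \<le> C" "x 1 + x 2 \<le> C'"
    and \<theta>: "Y12 * (\<theta> 1 - \<theta> 2) = x 1" "Y12 * (\<theta> 2 - \<theta> 1) = - x 1"
      "Y23 * (\<theta> 2 - \<theta> 3) = x 1 + x 2" "Y23 * (\<theta> 3 - \<theta> 2) = - (x 1 + x 2)"
    using f by (auto simp: feasible_iff feasible_dispatch_def algebra_simps)
  have b': "valid_bid (b 1)" "valid_bid (b 2)" "valid_bid (b 3)" "valid_bid (b 4)"
    using b by (auto simp: gens_eq)
  have price: "(\<forall>i\<in>nodes M. \<forall>n\<in>gens_at M i.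
           (x n > 0 \<longrightarrow>
              (\<exists>l r. (bid_fun (b n) has_real_derivative l) (at_left (x n)) \<and>
                     (bid_fun (b n) has_real_derivative r) (at_right (x n)) \<and>
                     l \<le> \<pi> i \<and> \<pi> i \<le> r)) \<and>
           (x n = 0 \<longrightarrow>
              (\<exists>r. (bid_fun (b n) has_real_derivative r) (at_right 0) \<and> \<pi> i \<le> r))) \<longleftrightarrow>
      (\<forall>n\<in>{1,2,3,4}. supports (b n) (x n) (\<pi> (bus n)))"
    using supports_iff_derivatives[OF b'(1) x(1)] supports_iff_derivatives[OF b'(2) x(2)]
      supports_iff_derivatives[OF b'(3) x(3)] supports_iff_derivatives[OF b'(4) x(4)]
    by (simp add: nodes_eq gens_at_eq)
  have line: "(\<exists>\<mu> :: nat \<Rightarrow> nat \<Rightarrow> real.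
        (\<forall>(i, j)\<in>lines M. \<mu> i j \<ge> 0) \<and>
        (\<forall>i\<in>nodes M.
           (\<Sum>j\<in>nodes M. admittance M i j * (\<pi> i - \<pi> j + \<mu> i j - \<mu> j i)) = 0) \<and>
        (\<forall>(i, j)\<in>lines M.
           \<mu> i j * (admittance M i j * (\<theta> i - \<theta> j) - capacity M i j) = 0)) \<longleftrightarrow>
      \<pi> 1 \<le> \<pi> 2 \<and> (x 1 < C \<longrightarrow> \<pi> 1 = \<pi> 2) \<and> \<pi> 2 \<le> \<pi> 3 \<and> (x 1 + x 2 < C' \<longrightarrow> \<pi> 2 = \<pi> 3)"
    (is "(\<exists>\<mu>. ?L \<mu>) \<longleftrightarrow> ?R")
  proof
    assume "\<exists>\<mu>. ?L \<mu>"
    then obtain \<mu> where \<mu>: "?L \<mu>" by blast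
    then have pos: "0 \<le> \<mu> 1 2" "0 \<le> \<mu> 2 3" by (auto simp: lines_eq)
    from \<mu> have "\<mu> 2 1 * (- x 1 - C) = 0" "\<mu> 3 2 * (- (x 1 + x 2) - C') = 0"
      and slack: "\<mu> 1 2 = 0 \<or> x 1 = C" "\<mu> 2 3 = 0 \<or> x 1 + x 2 = C'"
      by (auto simp: lines_eq admittance_eq capacity_eq \<theta>)
    then have zero: "\<mu> 2 1 = 0" "\<mu> 3 2 = 0" using x C by auto
    from \<mu> have "Y12 * (\<pi> 1 - \<pi> 2 + \<mu> 1 2 - \<mu> 2 1) = 0" "Y23 * (\<pi> 3 - \<pi> 2 + \<mu> 3 2 - \<mu> 2 3) = 0"
      unfolding sum_nodes nodes_eq by (simp_all add: admittance_eq)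
    then have "\<pi> 2 = \<pi> 1 + \<mu> 1 2" "\<pi> 3 = \<pi> 2 + \<mu> 2 3" using Y zero by auto
    with pos slack show ?R by auto
  next
    assume R: ?R
    define \<mu> where "\<mu> i j = (if (i, j) = (1, 2) \<or> (i, j) = (2, 3) then \<pi> j - \<pi> i else 0)" for i j
    have "?L \<mu>" using R x
      by (auto simp: lines_eq nodes_eq admittance_eq capacity_eq \<theta> \<mu>_def)
    then show "\<exists>\<mu>. ?L \<mu>" by blast
  qed
  have "optimal_multipliers M b x \<theta> \<pi> \<longleftrightarrow>
      (\<forall>n\<in>{1,2,3,4}. supports (b n) (x n) (\<pi> (bus n))) \<and>
      \<pi> 1 \<le> \<pi> 2 \<and> (x 1 < C \<longrightarrow> \<pi> 1 = \<pi> 2) \<and> \<pi> 2 \<le> \<pi> 3 \<and> (x 1 + x 2 < C' \<longrightarrow> \<pi> 2 = \<pi> 3)"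
    unfolding optimal_multipliers_def price line[symmetric] by blast
  then show ?thesis by (simp add: clearing_prices_def)
qed

section \<open>From clearing prices to outcomes and back\<close>

text \<open>Adding the subgradient inequalities bounds the cost change below by the price-weighted
  change of output. Summation by parts turns this into one term per line, nonnegative because prices
  differ only across saturated lines.\<close>

lemma clearing_prices_imp_optimal_dispatch:
  assumes f: "feasible M x \<theta>" and b: "\<And>n. n \<in> gens M \<Longrightarrow> valid_bid (b n)"
    and \<pi>: "clearing_prices C C' b x \<pi>"
  shows "optimal_dispatch M b x \<theta>"
  unfolding optimal_dispatch_def
proof (intro conjI allI impI)
  fix x' \<theta>' assume f': "feasible M x' \<theta>'"
  have sub: "bid_fun (b n) (x n) + \<pi> (bus n) * (x' n - x n) \<le> bid_fun (b n) (x' n)"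
    if "n \<in> {1,2,3,4}" for n
    using that b \<pi> f f'
    by (intro bid_fun_subgradient) (auto simp: clearing_prices_def gens_eq feasible_def)
  have x: "x 1 \<le> C" "x 1 + x 2 \<le> C'" "x 1 + x 2 + x 3 + x 4 = D"
    "x' 1 \<le> C" "x' 1 + x' 2 \<le> C'" "x' 1 + x' 2 + x' 3 + x' 4 = D"
    using f f' by (auto simp: feasible_iff feasible_dispatch_def)
  have "0 \<le> (\<pi> 2 - \<pi> 1) * (x 1 - x' 1)"
    using \<pi> x by (cases "x 1 < C") (auto simp: clearing_prices_def)
  moreover have "0 \<le> (\<pi> 3 - \<pi> 2) * ((x 1 + x 2) - (x' 1 + x' 2))"
    using \<pi> x by (cases "x 1 + x 2 < C'") (auto simp: clearing_prices_def)
  moreover have "\<pi> 1 * (x' 1 - x 1) + \<pi> 2 * (x' 2 - x 2) + \<pi> 3 * (x' 3 - x 3) + \<pi> 3 * (x' 4 - x 4) =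
      (\<pi> 2 - \<pi> 1) * (x 1 - x' 1) + (\<pi> 3 - \<pi> 2) * ((x 1 + x 2) - (x' 1 + x' 2))"
  proof -
    have e: "x 4 = D - x 1 - x 2 - x 3" "x' 4 = D - x' 1 - x' 2 - x' 3" using x by auto
    show ?thesis unfolding e by (simp add: algebra_simps)
  qed
  ultimately show "(\<Sum>n\<in>gens M. bid_fun (b n) (x n)) \<le> (\<Sum>n\<in>gens M. bid_fun (b n) (x' n))"
    using sub[of 1] sub[of 2] sub[of 3] sub[of 4] unfolding sum_gens by simp
qed (use f in auto)

text \<open>A dispatch supported by any clearing prices is optimal, and its componentwise least
  clearing prices are also lexicographically smallest.\<close>

lemma exists_outcome:
  assumes x: "feasible_dispatch C C' D x" and b: "\<And>n. n \<in> gens M \<Longrightarrow> valid_bid (b n)"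
    and \<pi>: "clearing_prices C C' b x \<pi>"
  obtains \<rho> where "clearing_prices C C' b x \<rho>" "outcome M b x \<rho>"
proof -
  obtain \<rho> where \<rho>: "clearing_prices C C' b x \<rho>"
    and least: "\<And>\<pi>'. clearing_prices C C' b x \<pi>' \<Longrightarrow> \<rho> 1 \<le> \<pi>' 1 \<and> \<rho> 2 \<le> \<pi>' 2 \<and> \<rho> 3 \<le> \<pi>' 3"
    using least_clearing_prices[OF C x \<pi>] by blast
  \<comment> \<open>Angles realizing the two flows, normalized to zero at node 2.\<close>
  define \<theta> where "\<theta> i = (if i = 1 then x 1 / Y12 else if i = 2 then 0 else - (x 1 + x 2) / Y23)" for i :: nat
  have f: "feasible M x \<theta>" using x Y by (auto simp: feasible_iff \<theta>_def)
  note mult = optimal_multipliers_iff[OF f b]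
  have "lex_le M \<rho> \<pi>'" if "clearing_prices C C' b x \<pi>'" for \<pi>'
    using least[OF that] by (auto simp: lex_le_def nodes_eq)
  then have "LMP M b x \<theta> \<rho>" using \<rho> by (simp add: LMP_def mult)
  moreover have "optimal_dispatch M b x \<theta>"
    using clearing_prices_imp_optimal_dispatch[OF f b \<rho>] by blast
  ultimately show thesis using that \<rho> by (auto simp: outcome_def)
qed

text \<open>For the third claim, the LMP is lexicographically at most the componentwise least
  clearing vector, which in turn lies below it in every component; so the two agree.\<close>

lemma outcomeD:
  assumes o: "outcome M b x \<pi>" and b: "\<And>n. n \<in> gens M \<Longrightarrow> valid_bid (b n)"
  shows "feasible_dispatch C C' D x" "clearing_prices C C' b x \<pi>"
    "clearing_prices C C' b x \<pi>' \<Longrightarrow> \<pi> 1 \<le> \<pi>' 1 \<and> \<pi> 2 \<le> \<pi>' 2 \<and> \<pi> 3 \<le> \<pi>' 3"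
proof -
  obtain \<theta> where opt: "optimal_dispatch M b x \<theta>" and lmp: "LMP M b x \<theta> \<pi>"
    using o by (auto simp: outcome_def)
  then have f: "feasible M x \<theta>" by (simp add: optimal_dispatch_def)
  note mult = optimal_multipliers_iff[OF f b]
  show x: "feasible_dispatch C C' D x" using f by (simp add: feasible_iff)
  show \<pi>: "clearing_prices C C' b x \<pi>" using lmp by (simp add: LMP_def mult)
  assume "clearing_prices C C' b x \<pi>'"
  obtain \<rho> where \<rho>: "clearing_prices C C' b x \<rho>"
    and least: "\<And>\<pi>'. clearing_prices C C' b x \<pi>' \<Longrightarrow> \<rho> 1 \<le> \<pi>' 1 \<and> \<rho> 2 \<le> \<pi>' 2 \<and> \<rho> 3 \<le> \<pi>' 3"
    using least_clearing_prices[OF C x \<pi>] by blast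
  have "lex_le M \<pi> \<rho>" using lmp \<rho> by (simp add: LMP_def mult)
  with least[OF \<pi>] have "\<pi> 1 = \<rho> 1 \<and> \<pi> 2 = \<rho> 2 \<and> \<pi> 3 = \<rho> 3"
    by (auto simp: lex_le_def nodes_eq)
  with least[OF \<open>clearing_prices C C' b x \<pi>'\<close>]
  show "\<pi> 1 \<le> \<pi>' 1 \<and> \<pi> 2 \<le> \<pi>' 2 \<and> \<pi> 3 \<le> \<pi>' 3" by simp
qed

end

section \<open>Deviations\<close>

locale three_node_equilibrium = three_node_line +
  fixes a :: "nat \<Rightarrow> real" and b :: "nat \<Rightarrow> bid" and x \<pi> :: "nat \<Rightarrow> real"
  assumes cost: "\<forall>n\<in>gens M. \<forall>y\<ge>0. cost M n y = a n * y"
    and a: "0 \<le> a 1" "a 1 < a 2" "a 2 < a 3" "a 3 < a 4"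
    and equilibrium: "nash_equilibrium M b x \<pi>"
begin

lemma valid: "n \<in> gens M \<Longrightarrow> valid_bid (b n)"
  using equilibrium by (simp add: nash_equilibrium_def)

lemma out: "outcome M b x \<pi>"
  using equilibrium by (simp add: nash_equilibrium_def)

lemma dispatch: "feasible_dispatch C C' D x"
  by (rule outcomeD(1)[OF out valid])

lemma clearing: "clearing_prices C C' b x \<pi>"
  by (rule outcomeD(2)[OF out valid])

lemma least: "clearing_prices C C' b x \<rho> \<Longrightarrow> \<pi> 1 \<le> \<rho> 1 \<and> \<pi> 2 \<le> \<rho> 2 \<and> \<pi> 3 \<le> \<rho> 3"
  by (rule outcomeD(3)[OF out valid])

lemma x_props:
  "0 \<le> x 1" "0 \<le> x 2" "0 \<le> x 3" "0 \<le> x 4" "x 1 \<le> C" "x 1 + x 2 \<le> C'" "x 1 + x 2 + x 3 + x 4 = D"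
  using dispatch by (auto simp: feasible_dispatch_def)

lemma supports_price: "n \<in> {1,2,3,4} \<Longrightarrow> supports (b n) (x n) (\<pi> (bus n))"
  using clearing unfolding clearing_prices_def by blast

lemma price_props:
  "supports (b 1) (x 1) (\<pi> 1)" "supports (b 2) (x 2) (\<pi> 2)"
  "supports (b 3) (x 3) (\<pi> 3)" "supports (b 4) (x 4) (\<pi> 3)"
  "\<pi> 1 \<le> \<pi> 2" "x 1 < C \<Longrightarrow> \<pi> 1 = \<pi> 2" "\<pi> 2 \<le> \<pi> 3" "x 1 + x 2 < C' \<Longrightarrow> \<pi> 2 = \<pi> 3"
  using clearing by (auto simp: clearing_prices_def)

section \<open>Basic deviations\<close>

lemma payoff_eq:
  assumes "n \<in> gens M" "0 \<le> y n"
  shows "payoff M y \<rho> n = (\<rho> (bus n) - a n) * y n"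
  using assms cost gen_node by (auto simp: payoff_def gens_eq algebra_simps)

text \<open>The prices \<open>\<rho>\<close> only certify that \<open>y\<close> can be dispatched.
  The LMP after the deviation may be lower, so the payoff bound is available only for some clearing
  \<open>\<sigma>\<close>.\<close>

lemma no_profitable_deviation:
  assumes n: "n \<in> {1,2,3,4}" and \<beta>: "valid_bid \<beta>" and y: "feasible_dispatch C C' D y"
    and \<rho>: "clearing_prices C C' (b(n := \<beta>)) y \<rho>"
  obtains \<sigma> where "clearing_prices C C' (b(n := \<beta>)) y \<sigma>"
    "(\<sigma> (bus n) - a n) * y n \<le> (\<pi> (bus n) - a n) * x n"
proof -
  have v: "valid_bid ((b(n := \<beta>)) m)" if "m \<in> gens M" for m using that \<beta> valid by auto
  from exists_outcome[OF y v \<rho>] obtain \<sigma>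
    where \<sigma>: "clearing_prices C C' (b(n := \<beta>)) y \<sigma>" "outcome M (b(n := \<beta>)) y \<sigma>" by blast
  have n': "n \<in> gens M" using n by (simp add: gens_eq)
  have "payoff M y \<sigma> n \<le> payoff M x \<pi> n"
    using equilibrium \<sigma>(2) \<beta> n' unfolding nash_equilibrium_def by force
  moreover have "0 \<le> y n" "0 \<le> x n" using n y x_props by (auto simp: feasible_dispatch_def)
  ultimately show thesis using that \<sigma>(1) by (simp add: payoff_eq n')
qed

text \<open>With the dispatch unchanged, generator \<open>n\<close> still sells, so its flat bid
  keeps every clearing price at its node at least \<open>P\<close>.\<close>

lemma no_profitable_raise:
  assumes n: "n \<in> {1,2,3,4}" and xn: "0 < x n" and P: "\<pi> (bus n) < P"
    and \<rho>: "clearing_prices C C' (b(n := flat_bid P)) x \<rho>"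
  shows False
proof -
  have "0 \<le> \<pi> (bus n)"
    using xn n clearing left_slope_nonneg[OF valid[of n], of "x n"]
    by (auto simp: clearing_prices_def supports_def gens_eq)
  then have "valid_bid (flat_bid P)" using P by (intro valid_flat_bid) simp
  from no_profitable_deviation[OF n this dispatch \<rho>] obtain \<sigma>
    where \<sigma>: "clearing_prices C C' (b(n := flat_bid P)) x \<sigma>"
      "(\<sigma> (bus n) - a n) * x n \<le> (\<pi> (bus n) - a n) * x n" by blast
  have "supports (flat_bid P) (x n) (\<sigma> (bus n))"
    using \<sigma>(1) n by (auto simp: clearing_prices_def split: if_splits)
  then have "P \<le> \<sigma> (bus n)" using xn by (simp add: supports_flat_bid)
  moreover have "\<sigma> (bus n) \<le> \<pi> (bus n)" using \<sigma>(2) xn by simp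
  ultimately show False using P by simp
qed

text \<open>
  The transferred amount \<open>d\<close> may be negative. After the transfer, generator \<open>m\<close> still has slope
  \<open>\<pi> (bus m)\<close> on both sides, which pins its price down.
\<close>
lemma no_profitable_transfer:
  assumes nm: "n \<in> {1,2,3,4}" "m \<in> {1,2,3,4}" "n \<noteq> m"
    and eq: "\<pi> (bus n) = \<pi> (bus m)" and nonneg: "0 \<le> \<pi> (bus m)"
    and y: "y = x(n := x n + d, m := x m - d)" "feasible_dispatch C C' D y"
    and m: "\<And>P. supports (b m) (y m) P \<longleftrightarrow> P = \<pi> (bus m)"
    and lines: "y 1 < C \<Longrightarrow> \<pi> 1 = \<pi> 2" "y 1 + y 2 < C' \<Longrightarrow> \<pi> 2 = \<pi> 3"
    and tied: "\<And>b' \<sigma>. clearing_prices C C' b' y \<sigma> \<Longrightarrow> \<sigma> (bus n) = \<sigma> (bus m)"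
  shows "(\<pi> (bus m) - a n) * d \<le> 0"
proof -
  \<comment> \<open>This bid accepts output \<open>y n\<close> at the old price without having to
    set that price; generator \<open>m\<close> does so, and \<open>tied\<close> carries it over to
    the node of \<open>n\<close>.\<close>
  define \<beta> where "\<beta> = step_bid (\<pi> (bus m)) (y n)"
  have yn: "0 \<le> y n" using y(2) nm by (auto simp: feasible_dispatch_def)
  then have \<beta>: "valid_bid \<beta>" using nonneg by (simp add: \<beta>_def valid_step_bid)
  have sup: "supports ((b(n := \<beta>)) k) (y k) (\<pi> (bus k))" if k: "k \<in> {1,2,3,4}" for k
  proof -
    consider "k = n" | "k = m" | "k \<noteq> n" "k \<noteq> m" by blast
    then show ?thesis
    proof cases
      case 1
      then show ?thesis using nonneg by (simp add: \<beta>_def supports_step_bid eq)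
    next
      case 2
      then show ?thesis using m nm by simp
    next
      case 3
      then show ?thesis using supports_price[OF k] by (simp add: y)
    qed
  qed
  have "clearing_prices C C' (b(n := \<beta>)) y \<pi>"
    unfolding clearing_prices_def using sup lines price_props(5,7) by blast
  from no_profitable_deviation[OF nm(1) \<beta> y(2) this] obtain \<sigma>
    where \<sigma>: "clearing_prices C C' (b(n := \<beta>)) y \<sigma>"
      "(\<sigma> (bus n) - a n) * y n \<le> (\<pi> (bus n) - a n) * x n" by blast
  have "supports ((b(n := \<beta>)) m) (y m) (\<sigma> (bus m))"
    using \<sigma>(1) nm unfolding clearing_prices_def by blast
  then have "\<sigma> (bus m) = \<pi> (bus m)" using m nm by simp
  with \<sigma>(2) tied[OF \<sigma>(1)] eq nm show ?thesis by (simp add: y algebra_simps)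
qed

section \<open>Bounds on the equilibrium prices\<close>

text \<open>Here \<open>n\<close> and \<open>k\<close> are the two generators at node 3. A
  loss-making seller \<open>n\<close> either shifts a little output to a rival with right slope
  \<open>\<pi> 3\<close>, at an unchanged price, or, if no such rival exists, raises its flat
  bid.\<close>

lemma no_sale_below_cost:
  fixes n k :: nat
  assumes nk: "(n, k) \<in> {(3, 4), (4, 3)}" and xn: "0 < x n"
  shows "a n \<le> \<pi> 3"
proof (rule ccontr)
  assume "\<not> a n \<le> \<pi> 3"
  then have less: "\<pi> 3 < a n" by simp
  have bus: "bus n = 3" "bus k = 3" and n: "n \<in> {1,2,3,4}" and k: "k \<in> {1,2,3,4}" "k \<noteq> n"
    and kn12: "n \<noteq> 1" "n \<noteq> 2" "k \<noteq> 1" "k \<noteq> 2"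
    using nk by auto
  have nonneg: "0 \<le> \<pi> 3"
    using xn nk price_props(3,4) left_slope_nonneg[OF valid[of n], of "x n"]
    by (auto simp: supports_def gens_eq)
  \<comment> \<open>The slack condition says that the output taken over by \<open>m\<close> fits
    strictly through the lines between \<open>m\<close> and node 3, so the prices at both ends stay
    tied.\<close>
  have withhold: "\<pi> 3 < right_slope (b m) (x m)"
    if m: "m \<in> {1,2,3,4}" "m \<noteq> n" and eq: "\<pi> (bus m) = \<pi> 3"
      and e: "0 < e" and slack: "\<And>d. 0 < d \<Longrightarrow> d < e \<Longrightarrow>
        (m \<le> 2 \<longrightarrow> x 1 + x 2 + d < C') \<and> (m = 1 \<longrightarrow> x 1 + d < C)"
    for m e
  proof (rule ccontr)
    assume "\<not> \<pi> 3 < right_slope (b m) (x m)"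
    moreover have "supports (b m) (x m) (\<pi> (bus m))" using m(1) by (rule supports_price)
    ultimately have P: "right_slope (b m) (x m) = \<pi> (bus m)" by (simp add: supports_def eq)
    have xm: "0 \<le> x m" using m x_props by auto
    have "0 < min e (x n)" using e xn by simp
    from increase_along_right_slope[OF xm this, where \<beta> = "b m"] obtain d
      where d: "0 < d" "d < min e (x n)"
        "\<And>P. supports (b m) (x m + d) P \<longleftrightarrow> P = right_slope (b m) (x m)" by blast
    define y where "y = x(n := x n + (- d), m := x m - (- d))"
    have mk: "m = k \<or> m = 2 \<or> m = 1" using m nk by auto
    have d': "m \<le> 2 \<Longrightarrow> x 1 + x 2 + d < C'" "m = 1 \<Longrightarrow> x 1 + d < C" "d < x n"
      using slack[of d] d by simp_all
    have "feasible_dispatch C C' D y"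
      using mk
    proof (elim disjE)
      assume "m = k"
      then show ?thesis using nk d(1) d'(3) x_props by (auto simp: y_def feasible_dispatch_def)
    next
      assume m2: "m = 2"
      show ?thesis using nk d(1) d'(1)[unfolded m2] d'(3) x_props
        by (auto simp: m2 y_def feasible_dispatch_def)
    next
      assume m1: "m = 1"
      show ?thesis using nk d(1) d'(1,2)[unfolded m1] d'(3) x_props
        by (auto simp: m1 y_def feasible_dispatch_def)
    qed
    moreover have "\<pi> 1 = \<pi> 2" if "y 1 < C"
      using that m kn12 d price_props(6) by (cases "m = 1") (auto simp: y_def)
    moreover have "\<pi> 2 = \<pi> 3" if "y 1 + y 2 < C'"
      using that m kn12 d price_props(8) by (cases "m \<le> 2") (auto simp: y_def)
    moreover have "\<sigma> (bus n) = \<sigma> (bus m)" if "clearing_prices C C' b' y \<sigma>" for b' \<sigma>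
      using mk
    proof (elim disjE)
      assume m2: "m = 2"
      then have "y 1 + y 2 < C'" using d' kn12 by (simp add: y_def)
      then show ?thesis using that bus m2 unfolding clearing_prices_def by simp
    next
      assume m1: "m = 1"
      then have "y 1 < C" "y 1 + y 2 < C'" using d' kn12 by (simp_all add: y_def)
      then show ?thesis using that bus m1 unfolding clearing_prices_def by simp
    qed (simp add: bus)
    moreover have "supports (b m) (y m) P \<longleftrightarrow> P = \<pi> (bus m)" for P
      using d(3) P by (simp add: y_def)
    ultimately have "(\<pi> (bus m) - a n) * (- d) \<le> 0"
      using m n bus eq nonneg
      by (intro no_profitable_transfer[of n m y "- d"]) (simp_all add: y_def)
    then show False using less d eq by (simp add: zero_le_mult_iff)
  qed
  \<comment> \<open>Among these bounds are the right slopes of all rivals connected to node 3 by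
    unsaturated lines. Their prices must rise together with \<open>\<pi> 3\<close>, and
    \<open>P = Min R\<close> respects each of these slopes.\<close>
  define R where "R = insert (a n) (insert (right_slope (b k) (x k))
    ((if x 1 + x 2 < C' then {right_slope (b 2) (x 2)} else {}) \<union>
     (if x 1 + x 2 < C' \<and> x 1 < C then {right_slope (b 1) (x 1)} else {})))"
  have "\<pi> 3 < right_slope (b k) (x k)"
    using k bus kn12 nk by (intro withhold[of k 1]) auto
  moreover have "\<pi> 3 < right_slope (b 2) (x 2)" if "x 1 + x 2 < C'"
    using that kn12 price_props(8) by (intro withhold[of 2 "C' - (x 1 + x 2)"]) auto
  moreover have "\<pi> 3 < right_slope (b 1) (x 1)" if "x 1 + x 2 < C'" "x 1 < C"
    using that kn12 price_props(6,8)
    by (intro withhold[of 1 "min (C' - (x 1 + x 2)) (C - x 1)"]) auto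
  ultimately have R: "\<forall>r\<in>R. \<pi> 3 < r" using less by (auto simp: R_def)
  have fin: "finite R" "R \<noteq> {}" by (auto simp: R_def)
  define P where "P = Min R"
  have P: "\<pi> 3 < P" using R fin by (simp add: P_def)
  have Pk: "P \<le> right_slope (b k) (x k)"
    unfolding P_def by (rule Min_le[OF fin(1)]) (simp add: R_def)
  have P2: "P \<le> right_slope (b 2) (x 2)" if "x 1 + x 2 < C'"
    unfolding P_def by (rule Min_le[OF fin(1)]) (simp add: R_def that)
  have P1: "P \<le> right_slope (b 1) (x 1)" if "x 1 + x 2 < C'" "x 1 < C"
    unfolding P_def by (rule Min_le[OF fin(1)]) (simp add: R_def that)
  define \<rho> where "\<rho> i = (if i = 3 \<or> (i = 2 \<and> x 1 + x 2 < C') \<or> (i = 1 \<and> x 1 + x 2 < C' \<and> x 1 < C)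
      then P else \<pi> i)" for i :: nat
  have \<rho>: "\<rho> 3 = P" "\<rho> 2 = (if x 1 + x 2 < C' then P else \<pi> 2)"
    "\<rho> 1 = (if x 1 + x 2 < C' \<and> x 1 < C then P else \<pi> 1)"
    by (simp_all add: \<rho>_def)
  have "supports (b k) (x k) (\<pi> 3)" using supports_price[OF k(1)] bus by simp
  then have supk: "supports (b k) (x k) P"
    using P Pk by (rule supports_mono_right[OF _ less_imp_le])
  have sup2: "supports (b 2) (x 2) (\<rho> 2)"
  proof (cases "x 1 + x 2 < C'")
    case True
    then have "\<pi> 2 \<le> P" using P price_props(8) by simp
    from supports_mono_right[OF price_props(2) this P2[OF True]] show ?thesis using True by (simp add: \<rho>)
  qed (use price_props(2) in \<open>simp add: \<rho>\<close>)
  have sup1: "supports (b 1) (x 1) (\<rho> 1)"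
  proof (cases "x 1 + x 2 < C' \<and> x 1 < C")
    case True
    then have "\<pi> 1 \<le> P" using P price_props(5,8) by simp
    from supports_mono_right[OF price_props(1) this] P1 True show ?thesis by (simp add: \<rho>)
  next
    case False
    then show ?thesis using price_props(1) unfolding \<rho>(3) by (simp only: if_False)
  qed
  have line1: "\<rho> 1 \<le> \<rho> 2 \<and> (x 1 < C \<longrightarrow> \<rho> 1 = \<rho> 2)"
    using P price_props(5-8) unfolding \<rho> by argo
  have line2: "\<rho> 2 \<le> \<rho> 3 \<and> (x 1 + x 2 < C' \<longrightarrow> \<rho> 2 = \<rho> 3)"
    using P price_props(7) unfolding \<rho> by argo
  have "supports ((b(n := flat_bid P)) m) (x m) (\<rho> (bus m))" if "m \<in> {1,2,3,4}" for m
  proof -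
    have "m = n \<or> m = k \<or> m = 1 \<or> m = 2" using that nk by auto
    then show ?thesis
      using sup1 sup2 supk bus k kn12 by (elim disjE) (simp_all add: supports_flat_bid \<rho>(1))
  qed
  then have "clearing_prices C C' (b(n := flat_bid P)) x \<rho>"
    unfolding clearing_prices_def using line1 line2 by blast
  with no_profitable_raise[OF n xn _ this] P bus show False by simp
qed

lemma price3_ge: "a 3 \<le> \<pi> 3"
proof -
  have "0 < x 3 \<or> 0 < x 4" using x_props C by auto
  then show ?thesis using no_sale_below_cost[of 3 4] no_sale_below_cost[of 4 3] a by auto
qed

text \<open>Across a saturated line \<open>\<pi> 1\<close> is bounded below only by the bid of
  generator 1, so minimality makes it the left slope. If it were below \<open>\<pi> 2\<close>, a
  flat bid at \<open>\<pi> 2\<close> would sell the same amount at a higher price.\<close>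

lemma saturated_line_price:
  assumes "x 1 = C"
  shows "left_slope (b 1) (x 1) = \<pi> 1" "\<pi> 1 = \<pi> 2"
proof -
  let ?l = "left_slope (b 1) (x 1)"
  have pos: "0 < x 1" using assms C by simp
  have l: "?l \<le> \<pi> 1" using price_props(1) pos by (simp add: supports_def)
  have "clearing_prices C C' b x (\<pi>(1 := ?l))"
    using clearing l assms left_slope_le_right_slope[OF valid[of 1]]
    by (auto simp: clearing_prices_def supports_def gens_eq)
  from least[OF this] l show "?l = \<pi> 1" by simp
  show "\<pi> 1 = \<pi> 2"
  proof (rule ccontr)
    assume "\<pi> 1 \<noteq> \<pi> 2"
    then have "\<pi> (bus 1) < \<pi> 2" using price_props(5) by simp
    moreover have "clearing_prices C C' (b(1 := flat_bid (\<pi> 2))) x (\<pi>(1 := \<pi> 2))"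
      using clearing by (auto simp: clearing_prices_def supports_flat_bid)
    ultimately show False using no_profitable_raise[of 1] pos by simp
  qed
qed

lemma price1_eq_price2: "\<pi> 1 = \<pi> 2"
  using saturated_line_price(2) price_props(6) x_props by force

lemma price2_gt: "a 2 < \<pi> 2"
proof (cases "x 1 + x 2 < C'")
  case True
  then show ?thesis using price_props(8) price3_ge a by simp
next
  case False
  then have sat: "x 1 + x 2 = C'" using x_props by simp
  show ?thesis
  proof (rule ccontr)
    assume "\<not> a 2 < \<pi> 2"
    then have low: "\<pi> 2 \<le> a 2" by simp
    from supply_at_price[OF valid[of 1] C(1), where P = "a 2"] obtain z
      where z: "0 \<le> z" "z \<le> C" "0 < z \<Longrightarrow> left_slope (b 1) z \<le> a 2"
        "z < C \<Longrightarrow> a 2 < right_slope (b 1) z"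
      by (auto simp: gens_eq)
    define P where "P = (if z < C then min (\<pi> 3) (right_slope (b 1) z) else \<pi> 3)"
    have P: "a 2 < P" "P \<le> \<pi> 3" "z < C \<Longrightarrow> P \<le> right_slope (b 1) z"
      using z price3_ge a by (auto simp: P_def)
    define y where "y = x(1 := z, 2 := C' - z)"
    define \<rho> where "\<rho> = \<pi>(1 := if z < C then P else left_slope (b 1) z, 2 := P)"
    have y: "feasible_dispatch C C' D y"
      using z C sat x_props by (auto simp: y_def feasible_dispatch_def)
    have "supports (b 1) z (\<rho> 1)"
      using z P left_slope_le_right_slope[OF valid[of 1]] by (auto simp: supports_def \<rho>_def gens_eq)
    then have "clearing_prices C C' (b(2 := flat_bid P)) y \<rho>"
      using z P C price_props(3,4)
      by (auto simp: clearing_prices_def supports_flat_bid y_def \<rho>_def)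
    moreover have "valid_bid (flat_bid P)" using P a by (intro valid_flat_bid) simp
    ultimately obtain \<sigma> where \<sigma>: "clearing_prices C C' (b(2 := flat_bid P)) y \<sigma>"
      "(\<sigma> (bus 2) - a 2) * y 2 \<le> (\<pi> (bus 2) - a 2) * x 2"
      using no_profitable_deviation[of 2] y by (metis insertI1 insertI2)
    have "supports (flat_bid P) (y 2) (\<sigma> 2)" using \<sigma>(1) by (simp add: clearing_prices_def)
    moreover have y2: "0 < y 2" using z C by (simp add: y_def)
    ultimately have "a 2 < \<sigma> 2" using P by (simp add: supports_flat_bid)
    then have "0 < (\<sigma> 2 - a 2) * y 2" using y2 by simp
    moreover have "(\<pi> 2 - a 2) * x 2 \<le> 0" using low x_props by (simp add: mult_le_0_iff)
    ultimately show False using \<sigma>(2) by simp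
  qed
qed

section \<open>Undercutting and the contradiction\<close>

text \<open>If the left slope of \<open>m\<close> were \<open>\<pi> 2\<close>, then \<open>m\<close>
  would stay marginal at that price after losing a little output, and \<open>n\<close> would profit
  from taking it over because \<open>a n < \<pi> 2\<close>.\<close>

lemma undercut:
  assumes nm: "n \<in> {1,2}" "m \<in> {1,2,3,4}" "n \<noteq> m" and xm: "0 < x m"
    and eq: "\<pi> (bus m) = \<pi> 2"
    and slack: "n = 1 \<Longrightarrow> m = 2 \<and> x 1 < C" "3 \<le> m \<Longrightarrow> x 1 < C \<and> x 1 + x 2 < C'"
  shows "left_slope (b m) (x m) < \<pi> 2"
proof (rule ccontr)
  assume "\<not> left_slope (b m) (x m) < \<pi> 2"
  moreover have "supports (b m) (x m) (\<pi> (bus m))" using nm by (intro supports_price)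
  ultimately have P: "left_slope (b m) (x m) = \<pi> (bus m)" using xm by (simp add: supports_def eq)
  \<comment> \<open>The room on the line whose flow the transfer increases. When generator 2 takes
    over from generator 1 no flow increases, and \<open>1\<close> is an arbitrary bound.\<close>
  define e where "e = (if n = 1 then C - x 1 else if 3 \<le> m then C' - (x 1 + x 2) else 1)"
  have "0 < e" using slack by (auto simp: e_def)
  from decrease_along_left_slope[OF xm this, where \<beta> = "b m"] obtain d
    where d: "0 < d" "d < e" "d < x m"
      "\<And>P. supports (b m) (x m - d) P \<longleftrightarrow> P = left_slope (b m) (x m)" by blast
  define y where "y = x(n := x n + d, m := x m - d)"
  have y1: "y 1 < C" and y: "feasible_dispatch C C' D y"
    using nm slack d x_props by (auto simp: y_def e_def feasible_dispatch_def)
  have tied: "\<sigma> (bus n) = \<sigma> (bus m)" if "clearing_prices C C' b' y \<sigma>" for b' \<sigma>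
    using that y1 nm slack d by (auto simp: y_def e_def clearing_prices_def)
  have "\<pi> 2 = \<pi> 3" if "y 1 + y 2 < C'"
    using that nm eq slack d price_props(8) by (auto simp: y_def)
  moreover have "supports (b m) (y m) P \<longleftrightarrow> P = \<pi> (bus m)" for P
    using d(4) P by (simp add: y_def)
  ultimately have "(\<pi> (bus m) - a n) * d \<le> 0"
    using nm eq price1_eq_price2 price2_gt a y tied
    by (intro no_profitable_transfer[of n m y d]) (auto simp: y_def[symmetric])
  then show False using nm d eq price2_gt a by (auto simp: mult_le_0_iff)
qed

lemma no_equilibrium: False
proof -
  have left1: "left_slope (b 1) (x 1) < \<pi> 2" if "0 < x 1"
    using undercut[of 2 1] that price1_eq_price2 by simp
  \<comment> \<open>Saturation would make the left slope of generator 1 equal to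
    \<open>\<pi> 2\<close>. Excluding it provides the slack needed to undercut the other
    sellers.\<close>
  have "x 1 \<noteq> C"
  proof
    assume "x 1 = C"
    with saturated_line_price(1) price1_eq_price2 have "left_slope (b 1) (x 1) = \<pi> 2" by argo
    with left1 \<open>x 1 = C\<close> C(1) show False by argo
  qed
  then have x1: "x 1 < C" using x_props(5) by argo
  have left2: "left_slope (b 2) (x 2) < \<pi> 2" if "0 < x 2"
    using undercut[of 1 2] that x1 by simp
  have left34: "left_slope (b m) (x m) < \<pi> 2" if "m \<in> {3,4}" "0 < x m" "x 1 + x 2 < C'" for m
    using undercut[of 2 m] that x1 price_props(8) by auto
  \<comment> \<open>The left slopes of all sellers whose price is tied to \<open>\<pi> 2\<close>;
    the entry \<open>a 2\<close> makes nonemptiness immediate. All lie below \<open>\<pi> 2\<close>,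
    so these prices can drop together to the maximum.\<close>
  define L where "L = insert (a 2) ((\<lambda>m. left_slope (b m) (x m)) `
      {m \<in> {1,2,3,4}. 0 < x m \<and> (3 \<le> m \<longrightarrow> x 1 + x 2 < C')})"
  have L: "\<forall>l\<in>L. l < \<pi> 2" "finite L" "L \<noteq> {}"
    using left1 left2 left34 price2_gt by (auto simp: L_def)
  define P where "P = Max L"
  have P: "P < \<pi> 2" using L by (simp add: P_def)
  have PL: "l \<le> P" if "l \<in> L" for l using that L by (simp add: P_def)
  define \<rho> where "\<rho> i = (if i = 3 \<and> x 1 + x 2 = C' then \<pi> i else P)" for i :: nat
  have "supports (b m) (x m) (\<rho> (bus m))" if m: "m \<in> {1,2,3,4}" for m
  proof (rule supports_mono_left)
    show "supports (b m) (x m) (\<pi> (bus m))" using m by (rule supports_price)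
    show "\<rho> (bus m) \<le> \<pi> (bus m)"
      using m P price1_eq_price2 price_props(7) by (auto simp: \<rho>_def)
    show "left_slope (b m) (x m) \<le> \<rho> (bus m)" if xm: "0 < x m"
    proof (cases "3 \<le> m \<and> x 1 + x 2 = C'")
      case True
      then show ?thesis using m xm price_props(3,4) by (auto simp: \<rho>_def supports_def)
    next
      case False
      then have "left_slope (b m) (x m) \<in> L" using m xm x_props(6) by (auto simp: L_def)
      moreover have "\<rho> (bus m) = P" using False m by (auto simp: \<rho>_def)
      ultimately show ?thesis using PL by simp
    qed
  qed
  moreover have "\<rho> 1 \<le> \<rho> 2" "\<rho> 1 = \<rho> 2" "\<rho> 2 \<le> \<rho> 3" "x 1 + x 2 < C' \<longrightarrow> \<rho> 2 = \<rho> 3"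
    using P price_props(7) by (simp_all add: \<rho>_def)
  ultimately have "clearing_prices C C' b x \<rho>"
    unfolding clearing_prices_def by blast
  from least[OF this] P show False by (simp add: \<rho>_def)
qed

end

theorem mainTheorem2:
  fixes M :: market
    and Y12 Y23 C C' D :: real
    and a :: "nat \<Rightarrow> real"
  assumes "power_market M"
    and "num_nodes M = 3"
    and "num_gens M = 4"
    and "Y12 > 0" and "Y23 > 0"
    and "\<forall>i\<in>nodes M. \<forall>j\<in>nodes M. admittance M i j =
           (if {i, j} = {1, 2} then Y12 else if {i, j} = {2, 3} then Y23 else 0)"
    and "capacity M 1 2 = C" and "capacity M 2 3 = C'"
    and "0 < C" and "C < C'"
    and "gen_node M 1 = 1" and "gen_node M 2 = 2" and "gen_node M 3 = 3" and "gen_node M 4 = 3"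
    and "demand M 1 = 0" and "demand M 2 = 0" and "demand M 3 = D"
    and "D > C'"
    and "\<forall>n\<in>gens M. \<forall>y\<ge>0. cost M n y = a n * y"
    and "0 \<le> a 1" and "a 1 < a 2" and "a 2 < a 3" and "a 3 < a 4"
  shows "\<not> (\<exists>b x \<pi>. nash_equilibrium M b x \<pi>)"
proof
  assume "\<exists>b x \<pi>. nash_equilibrium M b x \<pi>"
  then obtain b x \<pi> where "nash_equilibrium M b x \<pi>" by blast
  with assms interpret three_node_equilibrium M Y12 Y23 C C' D a b x \<pi>
    by unfold_locales
  show False by (rule no_equilibrium)
qed

end
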